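(* For every preorder $\tau$ on $[n]$, $h(\tau,z)=h(\tau^*,z)$, where $\tau^*$ is the dual preorder of $\tau$, i.e., $a\le b$ in $\tau^*$ if and only if $b\le a$ in $\tau$.
   Context: A preorder $\tau$ on $[n]=\{1,\dots,n\}$ is a reflexive and transitive relation $\le$ on $[n]$ (equivalently, a partial order on the blocks of a partition of $[n]$). A subset $I\subseteq[n]$ is an order ideal of $\tau$ if for every $b\in I$ one has $a\in I$ for all $a\le b$. The preorder polytope $\mathcal Q_\tau$ is the set of all $\boldsymbol x\in\mathbb R^n$ such that $x_i\ge0$ for all $i\in[n]$ and $\sum_{i\in I}x_i\le|I|$ for every order ideal $I$ of $\tau$. The $h$-polynomial of $\tau$ is $h(\tau,z)=\sum_{i\ge0}h_i(\tau)z^i$, where $h_i(\tau)$ is the number of lattice points (points of $\mathbb Z^n$) of $\mathcal Q_\tau$ having exactly $i$ positive coordinates. *)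

theory Defs
  imports
    Complex_Main
    "HOL-Library.FuncSet"
    "HOL-Computational_Algebra.Polynomial"
begin

text \<open>
  A preorder on \<open>{1..n}\<close> is a relation \<open>r\<close> with \<^term>\<open>preorder_on {1..n} r\<close>, where
  \<open>(a, b) \<in> r\<close> means \<open>a \<le> b\<close>; its dual is the converse \<open>r\<inverse>\<close>.
  Points of real n-space are functions \<open>x :: nat \<Rightarrow> real\<close> in \<^term>\<open>extensional {1..n}\<close>,
  so that equality of points is equality of their coordinates \<open>x 1, \<dots>, x n\<close>.
\<close>

definition order_ideal :: "nat \<Rightarrow> nat rel \<Rightarrow> nat set \<Rightarrow> bool" where
  "order_ideal n r I \<longleftrightarrow> I \<subseteq> {1..n} \<and> (\<forall>b\<in>I. \<forall>a. (a, b) \<in> r \<longrightarrow> a \<in> I)"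

definition preorder_polytope :: "nat \<Rightarrow> nat rel \<Rightarrow> (nat \<Rightarrow> real) set" where
  "preorder_polytope n r =
     {x \<in> extensional {1..n}.
        (\<forall>i\<in>{1..n}. 0 \<le> x i) \<and>
        (\<forall>I. order_ideal n r I \<longrightarrow> (\<Sum>i\<in>I. x i) \<le> real (card I))}"

definition polytope_lattice_points :: "nat \<Rightarrow> nat rel \<Rightarrow> (nat \<Rightarrow> real) set" where
  "polytope_lattice_points n r =
     {x \<in> preorder_polytope n r. \<forall>i\<in>{1..n}. x i \<in> \<int>}"

definition h_coeff :: "nat \<Rightarrow> nat rel \<Rightarrow> nat \<Rightarrow> nat" where
  "h_coeff n r i =
     card {x \<in> polytope_lattice_points n r. card {j \<in> {1..n}. 0 < x j} = i}"

text \<open>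
  The sum over all \<open>i \<ge> 0\<close> may be cut off at \<open>n\<close>, because at most \<open>n\<close> coordinates can be
  positive; lemma \<open>coeff_h_poly\<close> below confirms that no coefficient is lost.
\<close>

definition h_poly :: "nat \<Rightarrow> nat rel \<Rightarrow> nat poly" where
  "h_poly n r = (\<Sum>i\<le>n. monom (h_coeff n r i) i)"

lemma card_positive_le: "card {j \<in> {1..n}. 0 < (x :: nat \<Rightarrow> real) j} \<le> n"
proof -
  have "card {j \<in> {1..n}. 0 < x j} \<le> card {1..n}" by (rule card_mono) auto
  then show ?thesis by simp
qed

lemma h_coeff_eq_0: "n < i \<Longrightarrow> h_coeff n r i = 0"
proof -
  assume "n < i"
  then have "card {j \<in> {1..n}. 0 < x j} \<noteq> i" for x :: "nat \<Rightarrow> real"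
    using card_positive_le[of n x] by linarith
  then show ?thesis unfolding h_coeff_def by simp
qed

lemma coeff_h_poly: "coeff (h_poly n r) i = h_coeff n r i"
proof -
  have "coeff (h_poly n r) i = (\<Sum>k\<le>n. if k = i then h_coeff n r k else 0)"
    unfolding h_poly_def by (simp add: coeff_sum)
  also have "\<dots> = h_coeff n r i"
    using h_coeff_eq_0[of n i r] by (auto simp: not_le)
  finally show ?thesis .
qed

text \<open>The cardinality in \<open>h_coeff\<close> is that of a finite set.\<close>

lemma finite_polytope_lattice_points:
  assumes "preorder_on {1..n} r"
  shows "finite (polytope_lattice_points n r)"
proof (rule finite_subset)
  let ?T = "{1..n} \<rightarrow>\<^sub>E real_of_int ` {0..int n}"
  show "finite ?T" by (intro finite_PiE) auto
  have ideal: "order_ideal n r {1..n}"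
    using assms unfolding order_ideal_def preorder_on_def by auto
  show "polytope_lattice_points n r \<subseteq> ?T"
  proof
    fix x assume x: "x \<in> polytope_lattice_points n r"
    then have ext: "x \<in> extensional {1..n}"
      and nn: "\<And>i. i \<in> {1..n} \<Longrightarrow> 0 \<le> x i"
      and int: "\<And>i. i \<in> {1..n} \<Longrightarrow> x i \<in> \<int>"
      and tot: "(\<Sum>i\<in>{1..n}. x i) \<le> real n"
      using ideal unfolding polytope_lattice_points_def preorder_polytope_def by auto
    have "x i \<in> real_of_int ` {0..int n}" if i: "i \<in> {1..n}" for i
    proof -
      obtain m where m: "x i = real_of_int m" using int[OF i] by (auto elim: Ints_cases)
      have "x i \<le> (\<Sum>i\<in>{1..n}. x i)" using i nn by (intro member_le_sum) auto
      with tot m nn[OF i] have "m \<in> {0..int n}" by auto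
      with m show ?thesis by blast
    qed
    with ext show "x \<in> ?T" by (auto simp: PiE_def)
  qed
qed

end

theory Submission
  imports Defs
begin

text \<open>
  Write \<open>N s\<close> for the set of elements below \<open>s\<close> and \<open>N(A)\<close> for the union of the \<open>N s\<close>, \<open>s \<in> A\<close>.
  Lattice points with support \<open>S\<close> are the positive vectors \<open>x\<close> on \<open>S\<close> with \<open>x(A) \<le> |N(A)|\<close> for
  all \<open>A \<subseteq> S\<close>. For every finite bipartite graph their number equals the number of sets \<open>T\<close>
  with \<open>|T| = |S|\<close> such that \<open>S\<close> and \<open>T\<close> are perfectly matched (expressed by Hall's condition).
  Hence \<open>h\<^sub>k\<close> counts the pairs \<open>(S, T)\<close> of \<open>k\<close>-sets that are perfectly matched, and this is symmetric
  under duality.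

  Both counts satisfy the same recursion. Consider the vectors (resp. sets of size \<open>|S| - 1\<close>) that
  violate Hall's condition by exactly one. By submodularity the violated sets have a least
  member \<open>C\<close>, and the objects with given \<open>C\<close> split into an object on \<open>C\<close> that is critical
  with \<open>C\<close> itself as least violated set, and an object on \<open>S - C\<close> satisfying Hall's condition after the
  neighbours of \<open>C\<close> are removed. Those with \<open>s \<in> C\<close>, for a fixed \<open>s\<close>, are equinumerous with the
  objects satisfying Hall's condition on \<open>S - {s}\<close>; by induction on \<open>|S|\<close> this determines the number with
  \<open>C = S\<close>. Adding a new vertex \<open>e\<close> to the right-hand side gains precisely the objects whose \<open>C\<close>
  contains a neighbour of \<open>e\<close>, which gives an induction on \<open>|N(S)|\<close>.
\<close>

section \<open>Weighted Hall condition and least violated sets\<close>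

text \<open>The weight lets one predicate serve both counts: \<open>w = x\<close> gives the
  inequalities for vectors, the constant weight 1 the condition of Hall's marriage theorem.\<close>

definition hall :: "('a \<Rightarrow> nat) \<Rightarrow> ('a \<Rightarrow> 'b set) \<Rightarrow> 'a set \<Rightarrow> bool" where
  "hall w N S \<longleftrightarrow> (\<forall>A\<subseteq>S. sum w A \<le> card (\<Union>(N ` A)))"

text \<open>Call \<open>sum w A\<close> minus the number of neighbours of \<open>A\<close> the
  excess of \<open>A\<close>; it is compared through \<open>Suc\<close> to avoid truncated
  subtraction. The empty set has excess 0, so \<open>C\<close> is never empty.\<close>

definition crit :: "('a \<Rightarrow> nat) \<Rightarrow> ('a \<Rightarrow> 'b set) \<Rightarrow> 'a set \<Rightarrow> 'a set \<Rightarrow> bool" where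
  "crit w N S C \<longleftrightarrow> (\<forall>A\<subseteq>S. sum w A \<le> Suc (card (\<Union>(N ` A)))) \<and> C \<subseteq> S \<and>
     sum w C = Suc (card (\<Union>(N ` C))) \<and>
     (\<forall>A\<subseteq>S. sum w A = Suc (card (\<Union>(N ` A))) \<longrightarrow> C \<subseteq> A)"

lemma hallD: "hall w N S \<Longrightarrow> A \<subseteq> S \<Longrightarrow> sum w A \<le> card (\<Union>(N ` A))"
  by (simp add: hall_def)

lemma hall_one_cardD: "hall (\<lambda>_. 1) N S \<Longrightarrow> A \<subseteq> S \<Longrightarrow> card A \<le> card (\<Union>(N ` A))"
  using hallD[of "\<lambda>_. 1" N S A] by (simp only: card_eq_sum)

lemma crit_subset: "crit w N S C \<Longrightarrow> C \<subseteq> S"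
  by (simp add: crit_def)

lemma crit_le: "crit w N S C \<Longrightarrow> A \<subseteq> S \<Longrightarrow> sum w A \<le> Suc (card (\<Union>(N ` A)))"
  by (simp add: crit_def)

lemma crit_eq: "crit w N S C \<Longrightarrow> sum w C = Suc (card (\<Union>(N ` C)))"
  by (simp add: crit_def)

lemma crit_least: "crit w N S C \<Longrightarrow> A \<subseteq> S \<Longrightarrow> sum w A = Suc (card (\<Union>(N ` A))) \<Longrightarrow> C \<subseteq> A"
  by (simp add: crit_def)

lemma critI:
  assumes "\<And>A. A \<subseteq> S \<Longrightarrow> sum w A \<le> Suc (card (\<Union>(N ` A)))" "C \<subseteq> S"
    "sum w C = Suc (card (\<Union>(N ` C)))"
    "\<And>A. A \<subseteq> S \<Longrightarrow> sum w A = Suc (card (\<Union>(N ` A))) \<Longrightarrow> C \<subseteq> A"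
  shows "crit w N S C"
  using assms by (simp add: crit_def)

lemma crit_unique: "crit w N S C \<Longrightarrow> crit w N S D \<Longrightarrow> C = D"
  by (intro subset_antisym) (auto intro: crit_least crit_subset crit_eq del: subsetI)

lemma crit_not_hall: "crit w N S C \<Longrightarrow> \<not> hall w N S"
  using hallD[of w N S C] crit_subset[of w N S C] crit_eq[of w N S C] by linarith

lemma card_nbhd_mono:
  fixes N :: "'a \<Rightarrow> 'b set"
  assumes "finite B" "\<And>s. finite (N s)" "A \<subseteq> B"
  shows "card (\<Union>(N ` A)) \<le> card (\<Union>(N ` B))"
  by (rule card_mono) (use assms in auto)

lemma finite_subset_nbhd:
  fixes N :: "'a \<Rightarrow> 'b set"
  assumes "finite S" "\<And>s. finite (N s)" "T \<subseteq> \<Union>(N ` A)" "A \<subseteq> S"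
  shows "finite T"
  by (rule finite_subset[OF assms(3)], rule finite_UN_I) (use assms finite_subset in blast)+

text \<open>Neighbourhoods commute with unions, but a common neighbour of \<open>A\<close> and
  \<open>B\<close> need not be a neighbour of \<open>A \<inter> B\<close>.\<close>

lemma card_nbhd_submodular:
  fixes N :: "'a \<Rightarrow> 'b set"
  assumes "finite A" "finite B" "\<And>s. finite (N s)"
  shows "card (\<Union>(N ` (A \<union> B))) + card (\<Union>(N ` (A \<inter> B)))
       \<le> card (\<Union>(N ` A)) + card (\<Union>(N ` B))"
proof -
  have "card (\<Union>(N ` (A \<inter> B))) \<le> card (\<Union>(N ` A) \<inter> \<Union>(N ` B))"
    by (rule card_mono) (use assms in auto)
  moreover have "\<Union>(N ` (A \<union> B)) = \<Union>(N ` A) \<union> \<Union>(N ` B)" by auto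
  ultimately show ?thesis
    using card_Un_Int[of "\<Union>(N ` A)" "\<Union>(N ` B)"] assms by simp
qed

lemma card_nbhd_diff:
  fixes N :: "'a \<Rightarrow> 'b set"
  assumes "finite B" "finite C" "\<And>s. finite (N s)"
  shows "card (\<Union>(N ` (B \<union> C))) = card (\<Union>((\<lambda>s. N s - \<Union>(N ` C)) ` B)) + card (\<Union>(N ` C))"
proof -
  have "\<Union>(N ` (B \<union> C)) = \<Union>((\<lambda>s. N s - \<Union>(N ` C)) ` B) \<union> \<Union>(N ` C)" by auto
  moreover have "card (\<Union>((\<lambda>s. N s - \<Union>(N ` C)) ` B) \<union> \<Union>(N ` C)) =
      card (\<Union>((\<lambda>s. N s - \<Union>(N ` C)) ` B)) + card (\<Union>(N ` C))"
    by (rule card_Un_disjoint) (use assms in auto)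
  ultimately show ?thesis by simp
qed

text \<open>Violated sets are closed under intersection, so one of minimum cardinality lies in all
  others.\<close>

lemma crit_exists:
  fixes N :: "'a \<Rightarrow> 'b set"
  assumes fin: "finite S" "\<And>s. finite (N s)"
    and le: "\<And>A. A \<subseteq> S \<Longrightarrow> sum w A \<le> Suc (card (\<Union>(N ` A)))"
    and nh: "\<not> hall w N S"
  shows "\<exists>C. crit w N S C"
proof -
  define V where "V A \<longleftrightarrow> A \<subseteq> S \<and> sum w A = Suc (card (\<Union>(N ` A)))" for A
  have "\<exists>A. V A"
    using nh le unfolding hall_def V_def by (meson le_SucE)
  then obtain C where C: "V C" and least: "\<And>A. V A \<Longrightarrow> card C \<le> card A"
    using ex_has_least_nat[of V _ card] by blast
  have "C \<subseteq> A" if A: "V A" for A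
  proof -
    have f: "finite A" "finite C" using A C fin(1) by (auto simp: V_def dest: finite_subset)
    have "sum w (A \<union> C) + sum w (A \<inter> C) = sum w A + sum w C"
      using sum.union_inter[OF f] .
    moreover have sub: "A \<union> C \<subseteq> S" "A \<inter> C \<subseteq> S" using A C by (auto simp: V_def)
    \<comment> \<open>By submodularity the excesses of \<open>A \<union> C\<close> and
      \<open>A \<inter> C\<close> add up to at least two, and neither exceeds one, so both equal
      one.\<close>
    ultimately have "sum w (A \<inter> C) = Suc (card (\<Union>(N ` (A \<inter> C))))"
      using card_nbhd_submodular[of A C N, OF f fin(2)] A C le[OF sub(1)] le[OF sub(2)]
      unfolding V_def by linarith
    then have "V (A \<inter> C)" using sub by (simp add: V_def)
    then have "card C \<le> card (A \<inter> C)" by (rule least)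
    then have "A \<inter> C = C" using f by (intro card_seteq) auto
    then show ?thesis by auto
  qed
  then have "crit w N S C" using C le by (intro critI) (simp_all add: V_def)
  then show ?thesis ..
qed

text \<open>The least violated set contains \<open>s\<close> exactly when every violated set does,
  that is, when none survives in \<open>S - {s}\<close>. This describes the union over all
  \<open>C\<close> containing \<open>s\<close> without mentioning \<open>C\<close>.\<close>

lemma crit_mem_iff:
  fixes N :: "'a \<Rightarrow> 'b set"
  assumes fin: "finite S" "\<And>s. finite (N s)" and s: "s \<in> S"
  shows "(\<exists>C. s \<in> C \<and> crit w N S C) \<longleftrightarrow>
     (\<forall>A\<subseteq>S. sum w A \<le> Suc (card (\<Union>(N ` A)))) \<and> \<not> hall w N S \<and> hall w N (S - {s})"
    (is "?L \<longleftrightarrow> ?R")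
proof
  assume ?L
  then obtain C where C: "s \<in> C" "crit w N S C" by blast
  have "hall w N (S - {s})" unfolding hall_def
  proof (intro allI impI)
    fix A assume A: "A \<subseteq> S - {s}"
    then have AS: "A \<subseteq> S" "s \<notin> A" by auto
    then have "sum w A \<noteq> Suc (card (\<Union>(N ` A)))"
      using C(1) crit_least[OF C(2) AS(1)] by blast
    then show "sum w A \<le> card (\<Union>(N ` A))" using crit_le[OF C(2) AS(1)] by linarith
  qed
  then show ?R using C crit_not_hall[OF C(2)] crit_le[OF C(2)] by blast
next
  assume R: ?R
  then obtain C where C: "crit w N S C" using crit_exists[of S N w] fin by blast
  moreover have "s \<in> C"
  proof (rule ccontr)
    assume "s \<notin> C"
    then have "C \<subseteq> S - {s}" using crit_subset[OF C] by auto
    then have "sum w C \<le> card (\<Union>(N ` C))" using R hallD by blast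
    then show False using crit_eq[OF C] by simp
  qed
  ultimately show ?L by blast
qed

text \<open>Here \<^term>\<open>crit w N C C\<close> says that \<^term>\<open>C\<close> is violated by one and no proper subset of it is violated.\<close>
lemma crit_factor:
  fixes N :: "'a \<Rightarrow> 'b set"
  assumes fin: "finite S" "\<And>s. finite (N s)" and CS: "C \<subseteq> S"
  shows "crit w N S C \<longleftrightarrow> crit w N C C \<and> hall w (\<lambda>s. N s - \<Union>(N ` C)) (S - C)"
    (is "_ \<longleftrightarrow> _ \<and> hall w ?M _")
proof
  assume C: "crit w N S C"
  have fC: "finite C" using CS fin(1) finite_subset by blast
  \<comment> \<open>Since \<open>C\<close> has excess one and \<open>B \<union> C\<close> at most
    one, no excess is left for \<open>B\<close> once the neighbours of \<open>C\<close> are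
    removed.\<close>
  have "hall w ?M (S - C)" unfolding hall_def
  proof (intro allI impI)
    fix B assume B: "B \<subseteq> S - C"
    then have fB: "finite B" using fin(1) finite_subset by blast
    have "sum w (B \<union> C) = sum w B + sum w C"
      using B by (intro sum.union_disjoint fB fC) auto
    moreover have "sum w (B \<union> C) \<le> Suc (card (\<Union>(N ` (B \<union> C))))"
      using B CS by (intro crit_le[OF C]) auto
    moreover have "sum w C = Suc (card (\<Union>(N ` C)))" using C by (simp add: crit_def)
    ultimately show "sum w B \<le> card (\<Union>(?M ` B))"
      using card_nbhd_diff[of B C N, OF fB fC fin(2)] by simp
  qed
  moreover have "crit w N C C"
  proof (rule critI)
    fix A assume "A \<subseteq> C"
    then have A: "A \<subseteq> S" using CS by (rule subset_trans)
    show "sum w A \<le> Suc (card (\<Union>(N ` A)))" by (rule crit_le[OF C A])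
    show "C \<subseteq> A" if "sum w A = Suc (card (\<Union>(N ` A)))" by (rule crit_least[OF C A that])
  qed (use crit_eq[OF C] in auto)
  ultimately show "crit w N C C \<and> hall w ?M (S - C)" by blast
next
  assume a: "crit w N C C \<and> hall w ?M (S - C)"
  have fC: "finite C" using CS fin(1) finite_subset by blast
  \<comment> \<open>By submodularity, the excess of \<open>A\<close> is at most that of \<open>A \<inter> C\<close>.\<close>
  have key: "sum w A + card (\<Union>(N ` (A \<inter> C))) \<le> sum w (A \<inter> C) + card (\<Union>(N ` A))"
    if A: "A \<subseteq> S" for A
  proof -
    have fA: "finite A" using A fin(1) finite_subset by blast
    have "sum w A = sum w (A \<inter> C) + sum w (A - C)"
      using fA by (metis sum.Int_Diff)
    moreover have "sum w (A - C) \<le> card (\<Union>(?M ` (A - C)))"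
      using a A by (intro hallD[of w ?M "S - C"]) auto
    moreover have "card (\<Union>(N ` (A \<union> C))) = card (\<Union>(?M ` (A - C))) + card (\<Union>(N ` C))"
      using card_nbhd_diff[of "A - C" C N] fA fC fin(2) by simp
    ultimately show ?thesis using card_nbhd_submodular[of A C N, OF fA fC fin(2)] by linarith
  qed
  have inC: "sum w (A \<inter> C) \<le> Suc (card (\<Union>(N ` (A \<inter> C))))" for A
    using a by (intro crit_le[of w N C C]) auto
  have "sum w A \<le> Suc (card (\<Union>(N ` A)))" if "A \<subseteq> S" for A
    using key[OF that] inC[of A] by linarith
  moreover have "C \<subseteq> A" if "A \<subseteq> S" "sum w A = Suc (card (\<Union>(N ` A)))" for A
  proof -
    \<comment> \<open>Excess one at \<open>A\<close> passes to \<open>A \<inter> C\<close>, and the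
      only subset of \<open>C\<close> with excess one is \<open>C\<close> itself.\<close>
    have "sum w (A \<inter> C) = Suc (card (\<Union>(N ` (A \<inter> C))))"
      using key[OF that(1)] inC[of A] that(2) by linarith
    then have "C \<subseteq> A \<inter> C" using a by (intro crit_least[of w N C C]) auto
    then show ?thesis by auto
  qed
  ultimately show "crit w N S C" using a CS by (intro critI) (auto dest: crit_eq del: subsetI)
qed

text \<open>Losing \<open>e\<close> raises the excess by one for exactly the sets adjacent to
  \<open>e\<close>. So Hall's condition holds with \<open>e\<close> iff without \<open>e\<close> no
  excess is above one and every violated set is adjacent to \<open>e\<close>; for the latter it
  suffices to look at the least violated set.\<close>

lemma hall_delete:
  fixes N :: "'a \<Rightarrow> 'b set"
  assumes fin: "finite S" "\<And>s. finite (N s)"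
  shows "hall w N S \<longleftrightarrow> hall w (\<lambda>s. N s - {e}) S \<or>
     (\<exists>C. crit w (\<lambda>s. N s - {e}) S C \<and> (\<exists>s\<in>C. e \<in> N s))"
    (is "_ \<longleftrightarrow> hall w ?M S \<or> _")
proof -
  have finM: "finite (?M s)" for s using fin by simp
  have c: "card (\<Union>(N ` A)) = card (\<Union>(?M ` A)) + (if \<exists>s\<in>A. e \<in> N s then 1 else 0)"
    if "A \<subseteq> S" for A
  proof -
    have f: "finite (\<Union>(?M ` A))" using finite_subset[OF that fin(1)] finM by (intro finite_UN_I)
    show ?thesis
    proof (cases "\<exists>s\<in>A. e \<in> N s")
      case True
      then have eq: "\<Union>(N ` A) = insert e (\<Union>(?M ` A))" by blast
      have "e \<notin> \<Union>(?M ` A)" by blast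
      with True show ?thesis unfolding eq by (subst card_insert_disjoint[OF f]) auto
    next
      case False
      then have "?M s = N s" if "s \<in> A" for s using that by blast
      then have "\<Union>(?M ` A) = \<Union>(N ` A)" by (intro SUP_cong refl)
      with False show ?thesis by (simp only: if_False add_0_right)
    qed
  qed
  show ?thesis
  proof
    assume h: "hall w N S"
    show "hall w ?M S \<or> (\<exists>C. crit w ?M S C \<and> (\<exists>s\<in>C. e \<in> N s))"
    proof (cases "hall w ?M S")
      case False
      have "sum w A \<le> Suc (card (\<Union>(?M ` A)))" if "A \<subseteq> S" for A
        using hallD[OF h that] unfolding c[OF that] by (simp only: split: if_splits)
      then obtain C where C: "crit w ?M S C"
        using crit_exists[OF fin(1) finM _ False] by blast
      have CS: "C \<subseteq> S" using crit_subset[OF C] .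
      have "\<exists>s\<in>C. e \<in> N s"
        using hallD[OF h CS] unfolding c[OF CS] crit_eq[OF C] by (simp only: split: if_splits)
      with C show ?thesis by blast
    qed simp
  next
    assume "hall w ?M S \<or> (\<exists>C. crit w ?M S C \<and> (\<exists>s\<in>C. e \<in> N s))"
    then show "hall w N S"
    proof (elim disjE exE conjE)
      assume h: "hall w ?M S"
      show ?thesis unfolding hall_def using hallD[OF h] c trans_le_add1 by metis
    next
      fix C assume C: "crit w ?M S C" and s: "\<exists>s\<in>C. e \<in> N s"
      show ?thesis unfolding hall_def
      proof (intro allI impI)
        fix A assume A: "A \<subseteq> S"
        show "sum w A \<le> card (\<Union>(N ` A))"
        proof (cases "sum w A = Suc (card (\<Union>(?M ` A)))")
          case True
          then have "C \<subseteq> A" by (rule crit_least[OF C A])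
          then have "\<exists>s\<in>A. e \<in> N s" using s by blast
          then show ?thesis unfolding True c[OF A] by (simp only: if_True)
        next
          case False
          then show ?thesis using crit_le[OF C A] unfolding c[OF A] by linarith
        qed
      qed
    qed
  qed
qed

section \<open>The vectors and sets to be counted\<close>

text \<open>Fixing the support forces the value 0 outside \<open>S\<close>, so these total functions
  are faithful copies of positive vectors on \<open>S\<close>.\<close>

definition hall_vecs :: "('a \<Rightarrow> 'b set) \<Rightarrow> 'a set \<Rightarrow> ('a \<Rightarrow> nat) set" where
  "hall_vecs N S = {x. {s. 0 < x s} = S \<and> hall x N S}"

definition crit_vecs :: "('a \<Rightarrow> 'b set) \<Rightarrow> 'a set \<Rightarrow> 'a set \<Rightarrow> ('a \<Rightarrow> nat) set" where
  "crit_vecs N S C = {x. {s. 0 < x s} = S \<and> crit x N S C}"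

definition hall_sets :: "('a \<Rightarrow> 'b set) \<Rightarrow> 'a set \<Rightarrow> 'b set set" where
  "hall_sets N S = {T. T \<subseteq> \<Union>(N ` S) \<and> card T = card S \<and> hall (\<lambda>_. 1) (\<lambda>s. N s \<inter> T) S}"

text \<open>\<open>T\<close> is one element too small, so \<open>S\<close> itself always has excess
  at least one.\<close>

definition crit_sets :: "('a \<Rightarrow> 'b set) \<Rightarrow> 'a set \<Rightarrow> 'a set \<Rightarrow> 'b set set" where
  "crit_sets N S C =
     {T. T \<subseteq> \<Union>(N ` S) \<and> Suc (card T) = card S \<and> crit (\<lambda>_. 1) (\<lambda>s. N s \<inter> T) S C}"

lemma crit_vecsD:
  assumes "x \<in> crit_vecs N S C"
  shows "{s. 0 < x s} = S" "crit x N S C"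
  using assms by (simp_all only: crit_vecs_def mem_Collect_eq)

lemma hall_vecsD:
  assumes "x \<in> hall_vecs N S"
  shows "{s. 0 < x s} = S" "hall x N S"
  using assms by (simp_all only: hall_vecs_def mem_Collect_eq)

lemma crit_setsD:
  assumes "T \<in> crit_sets N S C"
  shows "T \<subseteq> \<Union>(N ` S)" "Suc (card T) = card S" "crit (\<lambda>_. 1) (\<lambda>s. N s \<inter> T) S C"
  using assms by (simp_all only: crit_sets_def mem_Collect_eq)

lemma hall_setsD:
  assumes "T \<in> hall_sets N S"
  shows "T \<subseteq> \<Union>(N ` S)" "card T = card S" "hall (\<lambda>_. 1) (\<lambda>s. N s \<inter> T) S"
  using assms by (simp_all only: hall_sets_def mem_Collect_eq)

lemma finite_crit_sets:
  fixes N :: "'a \<Rightarrow> 'b set"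
  assumes "finite S" "\<And>s. finite (N s)"
  shows "finite (crit_sets N S C)"
proof (rule finite_subset)
  show "crit_sets N S C \<subseteq> Pow (\<Union>(N ` S))" by (intro subsetI PowI crit_setsD(1))
  show "finite (Pow (\<Union>(N ` S)))" using assms by simp
qed

lemma finite_hall_sets:
  fixes N :: "'a \<Rightarrow> 'b set"
  assumes "finite S" "\<And>s. finite (N s)"
  shows "finite (hall_sets N S)"
proof (rule finite_subset)
  show "hall_sets N S \<subseteq> Pow (\<Union>(N ` S))" by (intro subsetI PowI hall_setsD(1))
  show "finite (Pow (\<Union>(N ` S)))" using assms by simp
qed

lemma finite_if_bounded_support:
  assumes S: "finite S"
    and le: "\<And>x s. x \<in> F \<Longrightarrow> s \<in> S \<Longrightarrow> x s \<le> b"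
    and supp: "\<And>x. x \<in> F \<Longrightarrow> {s. 0 < x s} = S"
  shows "finite (F :: ('a \<Rightarrow> nat) set)"
proof (rule finite_subset)
  show "F \<subseteq> {f. \<forall>s. (s \<in> S \<longrightarrow> f s \<in> {..b}) \<and> (s \<notin> S \<longrightarrow> f s = 0)}"
  proof (intro subsetI CollectI allI conjI impI)
    fix x s assume x: "x \<in> F"
    show "x s \<in> {..b}" if "s \<in> S" using le[OF x that] by simp
    show "x s = 0" if "s \<notin> S"
      using that unfolding supp[OF x, symmetric] by simp
  qed
  show "finite {f. \<forall>s. (s \<in> S \<longrightarrow> f s \<in> {..b}) \<and> (s \<notin> S \<longrightarrow> f s = (0::nat))}"
    by (rule finite_set_of_finite_funs) (use S in auto)
qed

lemma finite_crit_vecs: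
  fixes N :: "'a \<Rightarrow> 'b set"
  assumes fin: "finite S" "\<And>s. finite (N s)"
  shows "finite (crit_vecs N S C)"
proof (rule finite_if_bounded_support[OF fin(1)])
  fix x s assume "x \<in> crit_vecs N S C" "s \<in> S"
  then have "sum x {s} \<le> Suc (card (\<Union>(N ` {s})))"
    by (intro crit_le[OF crit_vecsD(2)]) auto
  also have "\<dots> \<le> Suc (card (\<Union>(N ` S)))"
    using card_nbhd_mono[of S N "{s}"] fin \<open>s \<in> S\<close> by simp
  finally show "x s \<le> Suc (card (\<Union>(N ` S)))" by simp
qed (rule crit_vecsD(1))

lemma finite_hall_vecs:
  fixes N :: "'a \<Rightarrow> 'b set"
  assumes fin: "finite S" "\<And>s. finite (N s)"
  shows "finite (hall_vecs N S)"
proof (rule finite_if_bounded_support[OF fin(1)])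
  fix x s assume "x \<in> hall_vecs N S" "s \<in> S"
  then have "sum x {s} \<le> card (\<Union>(N ` {s}))"
    by (intro hallD[OF hall_vecsD(2)]) auto
  also have "\<dots> \<le> card (\<Union>(N ` S))"
    using card_nbhd_mono[of S N "{s}"] fin \<open>s \<in> S\<close> by simp
  finally show "x s \<le> card (\<Union>(N ` S))" by simp
qed (rule hall_vecsD(1))

lemma hall_cong: "(\<And>s. s \<in> S \<Longrightarrow> w s = w' s) \<Longrightarrow> (\<And>s. s \<in> S \<Longrightarrow> N s = N' s) \<Longrightarrow> hall w N S = hall w' N' S"
  unfolding hall_def
  by (intro all_cong1 imp_cong refl arg_cong2[where f = "(\<le>)"] sum.cong arg_cong[where f = card] SUP_cong)
    auto

lemma crit_congD:
  assumes c: "crit w N S C"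
    and eq: "\<And>s. s \<in> S \<Longrightarrow> w s = w' s" "\<And>s. s \<in> S \<Longrightarrow> N s = N' s"
  shows "crit w' N' S C"
proof -
  have w: "sum w' A = sum w A" if "A \<subseteq> S" for A
    using that eq(1) by (intro sum.cong) auto
  have N: "\<Union>(N' ` A) = \<Union>(N ` A)" if "A \<subseteq> S" for A
    using that eq(2) by (intro SUP_cong) auto
  show ?thesis
  proof (rule critI)
    show CS: "C \<subseteq> S" by (rule crit_subset[OF c])
    show "sum w' C = Suc (card (\<Union>(N' ` C)))"
      unfolding w[OF CS] N[OF CS] by (rule crit_eq[OF c])
    fix A assume A: "A \<subseteq> S"
    show "sum w' A \<le> Suc (card (\<Union>(N' ` A)))"
      unfolding w[OF A] N[OF A] by (rule crit_le[OF c A])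
    show "C \<subseteq> A" if "sum w' A = Suc (card (\<Union>(N' ` A)))"
      using that unfolding w[OF A] N[OF A] by (rule crit_least[OF c A])
  qed
qed

lemma crit_cong:
  assumes "\<And>s. s \<in> S \<Longrightarrow> w s = w' s" "\<And>s. s \<in> S \<Longrightarrow> N s = N' s"
  shows "crit w N S C = crit w' N' S C"
  using assms by (intro iffI; elim crit_congD) auto

section \<open>Product formula for critical objects\<close>

text \<open>By \<open>crit_factor\<close> the constraints inside and outside \<open>C\<close> are
  independent, so cutting a vector into its two restrictions is a bijection onto a product.\<close>

lemma card_crit_vecs_factor:
  fixes N :: "'a \<Rightarrow> 'b set"
  assumes fin: "finite S" "\<And>s. finite (N s)" and CS: "C \<subseteq> S"
  shows "card (crit_vecs N S C) =
    card (crit_vecs N C C) * card (hall_vecs (\<lambda>s. N s - \<Union>(N ` C)) (S - C))"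
proof -
  let ?M = "\<lambda>s. N s - \<Union>(N ` C)"
  \<comment> \<open>Padding with 0 makes the supports exactly \<open>C\<close> and
    \<open>S - C\<close>.\<close>
  let ?f = "\<lambda>x. (\<lambda>s. if s \<in> C then x s else 0, \<lambda>s. if s \<in> C then 0 else x s)"
  let ?g = "\<lambda>(y, z) s. if s \<in> C then y s else z s"
  have "bij_betw ?f (crit_vecs N S C) (crit_vecs N C C \<times> hall_vecs ?M (S - C))"
  proof (rule bij_betw_byWitness[where f' = ?g])
    show "\<forall>x\<in>crit_vecs N S C. ?g (?f x) = x" by auto
    show "\<forall>p\<in>crit_vecs N C C \<times> hall_vecs ?M (S - C). ?f (?g p) = p"
    proof (intro ballI, elim SigmaE)
      fix p y z assume p: "p = (y, z)" and y: "y \<in> crit_vecs N C C" and z: "z \<in> hall_vecs ?M (S - C)"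
      have "y s = 0" if "s \<notin> C" for s using that crit_vecsD(1)[OF y, symmetric] by simp
      moreover have "z s = 0" if "s \<in> C" for s using that hall_vecsD(1)[OF z] by fastforce
      ultimately show "?f (?g p) = p" unfolding p by auto
    qed
    show "?f ` crit_vecs N S C \<subseteq> crit_vecs N C C \<times> hall_vecs ?M (S - C)"
    proof (rule image_subsetI)
      fix x assume "x \<in> crit_vecs N S C"
      note x = crit_vecsD[OF this]
      let ?y = "\<lambda>s. if s \<in> C then x s else 0" and ?z = "\<lambda>s. if s \<in> C then 0 else x s"
      have "crit x N C C" "hall x ?M (S - C)" using crit_factor[of S N, OF fin CS] x(2) by blast+
      moreover have "crit x N C C = crit ?y N C C" by (rule crit_cong) auto
      moreover have "hall x ?M (S - C) = hall ?z ?M (S - C)" by (rule hall_cong) auto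
      moreover have "{s. 0 < ?y s} = C" "{s. 0 < ?z s} = S - C"
        using CS unfolding x(1)[symmetric] by (auto split: if_splits)
      ultimately show "?f x \<in> crit_vecs N C C \<times> hall_vecs ?M (S - C)"
        unfolding crit_vecs_def hall_vecs_def by blast
    qed
    show "?g ` (crit_vecs N C C \<times> hall_vecs ?M (S - C)) \<subseteq> crit_vecs N S C"
    proof (intro image_subsetI, elim SigmaE)
      fix p y z assume p: "p = (y, z)" and y: "y \<in> crit_vecs N C C" and z: "z \<in> hall_vecs ?M (S - C)"
      let ?x = "\<lambda>s. if s \<in> C then y s else z s"
      have "crit y N C C = crit ?x N C C" by (rule crit_cong) auto
      moreover have "hall z ?M (S - C) = hall ?x ?M (S - C)" by (rule hall_cong) auto
      ultimately have "crit ?x N S C"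
        using crit_factor[of S N, OF fin CS, of ?x] crit_vecsD(2)[OF y] hall_vecsD(2)[OF z] by simp
      moreover have "0 < ?x s \<longleftrightarrow> s \<in> S" for s
        using crit_vecsD(1)[OF y] hall_vecsD(1)[OF z] CS
        unfolding set_eq_iff mem_Collect_eq Diff_iff by auto
      then have "{s. 0 < ?x s} = S" by (intro set_eqI) (simp only: mem_Collect_eq)
      ultimately have "?x \<in> crit_vecs N S C" unfolding crit_vecs_def by blast
      then show "?g p \<in> crit_vecs N S C" unfolding p by simp
    qed
  qed
  from bij_betw_same_card[OF this] show ?thesis unfolding card_cartesian_product .
qed

text \<open>\<open>T\<close> is cut along the neighbourhood \<open>?U\<close> of \<open>C\<close>:
  vertices in \<open>C\<close> see only \<open>T \<inter> ?U\<close>, and the others, after removal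
  of \<open>?U\<close>, only \<open>T - ?U\<close>.\<close>

lemma card_crit_sets_factor:
  fixes N :: "'a \<Rightarrow> 'b set"
  assumes fin: "finite S" "\<And>s. finite (N s)" and CS: "C \<subseteq> S"
  shows "card (crit_sets N S C) =
    card (crit_sets N C C) * card (hall_sets (\<lambda>s. N s - \<Union>(N ` C)) (S - C))"
proof -
  let ?U = "\<Union>(N ` C)"
  let ?M = "\<lambda>s. N s - ?U"
  have fC: "finite C" using CS fin(1) finite_subset by blast
  have finT: "finite T" if "T \<subseteq> \<Union>(N ` A)" "A \<subseteq> S" for T A
    using finite_subset_nbhd[of S N, OF fin that] .
  have cS: "card S = card C + card (S - C)"
    using fin(1) CS by (metis card_Diff_subset card_mono fC le_add_diff_inverse)
  have restr: "crit (\<lambda>_. 1) (\<lambda>s. N s \<inter> T) S C \<longleftrightarrow>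
      crit (\<lambda>_. 1) (\<lambda>s. N s \<inter> (T \<inter> ?U)) C C \<and> hall (\<lambda>_. 1) (\<lambda>s. ?M s \<inter> (T - ?U)) (S - C)" for T
  proof -
    have "crit (\<lambda>_. 1) (\<lambda>s. N s \<inter> T) C C = crit (\<lambda>_. 1) (\<lambda>s. N s \<inter> (T \<inter> ?U)) C C"
      by (rule crit_cong) auto
    moreover have "hall (\<lambda>_. 1) (\<lambda>s. N s \<inter> T - \<Union>((\<lambda>s. N s \<inter> T) ` C)) (S - C)
        = hall (\<lambda>_. 1) (\<lambda>s. ?M s \<inter> (T - ?U)) (S - C)"
      by (rule hall_cong) auto
    ultimately show ?thesis using crit_factor[of S "\<lambda>s. N s \<inter> T" C "\<lambda>_. 1"] fin CS by simp
  qed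
  let ?f = "\<lambda>T. (T \<inter> ?U, T - ?U)"
  let ?g = "\<lambda>(A, B). A \<union> B"
  have "bij_betw ?f (crit_sets N S C) (crit_sets N C C \<times> hall_sets ?M (S - C))"
  proof (rule bij_betw_byWitness[where f' = ?g])
    show "\<forall>x\<in>crit_sets N S C. ?g (?f x) = x" by auto
    have AB: "(A \<union> B) \<inter> ?U = A \<and> (A \<union> B) - ?U = B \<and> A \<inter> B = {} \<and> A \<union> B \<subseteq> \<Union>(N ` S)"
      if A: "A \<in> crit_sets N C C" and B: "B \<in> hall_sets ?M (S - C)" for A B
      using crit_setsD(1)[OF A] hall_setsD(1)[OF B] CS by blast
    then show "\<forall>p\<in>crit_sets N C C \<times> hall_sets ?M (S - C). ?f (?g p) = p" by auto
    show "?f ` crit_sets N S C \<subseteq> crit_sets N C C \<times> hall_sets ?M (S - C)"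
    proof (rule image_subsetI)
      fix T assume "T \<in> crit_sets N S C"
      note T = crit_setsD[OF this]
      have "\<Union>((\<lambda>s. N s \<inter> T) ` C) = T \<inter> ?U" by blast
      \<comment> \<open>Excess one of \<open>C\<close> means that \<open>T \<inter> ?U\<close> is
        one smaller than \<open>C\<close>. This uses up the deficit of \<open>T\<close>, so
        \<open>T - ?U\<close> has the size of \<open>S - C\<close>.\<close>
      then have cC: "card C = Suc (card (T \<inter> ?U))" using crit_eq[OF T(3)] by simp
      have "card T = card (T \<inter> ?U) + card (T - ?U)"
        using finT[OF T(1) subset_refl] by (simp only: card_Int_Diff)
      then have "card (T - ?U) = card (S - C)" using cC cS T(2) by linarith
      moreover have "T \<inter> ?U \<subseteq> ?U" "T - ?U \<subseteq> \<Union>(?M ` (S - C))" using T(1) by blast+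
      ultimately show "?f T \<in> crit_sets N C C \<times> hall_sets ?M (S - C)"
        using cC T(3) unfolding restr[of T] crit_sets_def hall_sets_def mem_Times_iff by simp
    qed
    show "?g ` (crit_sets N C C \<times> hall_sets ?M (S - C)) \<subseteq> crit_sets N S C"
    proof (intro image_subsetI, elim SigmaE)
      fix p A B assume p: "p = (A, B)" and A: "A \<in> crit_sets N C C" and B: "B \<in> hall_sets ?M (S - C)"
      have eq: "(A \<union> B) \<inter> ?U = A" "(A \<union> B) - ?U = B" and sub: "A \<inter> B = {}" "A \<union> B \<subseteq> \<Union>(N ` S)"
        using AB[OF A B] by blast+
      have "card (A \<union> B) = card A + card B"
        using finT[OF sub(2) subset_refl] sub(1) by (intro card_Un_disjoint) auto
      then have "Suc (card (A \<union> B)) = card S"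
        using cS crit_setsD(2)[OF A] hall_setsD(2)[OF B] by linarith
      moreover have "crit (\<lambda>_. 1) (\<lambda>s. N s \<inter> (A \<union> B)) S C"
        unfolding restr[of "A \<union> B"] eq using crit_setsD(3)[OF A] hall_setsD(3)[OF B] ..
      ultimately have "A \<union> B \<in> crit_sets N S C" unfolding crit_sets_def using sub by blast
      then show "?g p \<in> crit_sets N S C" unfolding p by simp
    qed
  qed
  from bij_betw_same_card[OF this] show ?thesis unfolding card_cartesian_product .
qed

section \<open>Classification by least violated set and deletion of a right-hand vertex\<close>

lemma hall_vecs_disjoint:
  assumes "S \<noteq> S'"
  shows "hall_vecs N S \<inter> hall_vecs N S' = {}"
proof (rule equals0I)
  fix x assume "x \<in> hall_vecs N S \<inter> hall_vecs N S'"
  then have x: "x \<in> hall_vecs N S" "x \<in> hall_vecs N S'" by simp_all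
  show False using hall_vecsD(1)[OF x(1)] hall_vecsD(1)[OF x(2)] assms by simp
qed

lemma crit_vecs_disjoint:
  assumes "C \<noteq> D"
  shows "crit_vecs N S C \<inter> crit_vecs N S D = {}"
proof (rule equals0I)
  fix x assume "x \<in> crit_vecs N S C \<inter> crit_vecs N S D"
  then have x: "x \<in> crit_vecs N S C" "x \<in> crit_vecs N S D" by simp_all
  show False using crit_unique[OF crit_vecsD(2)[OF x(1)] crit_vecsD(2)[OF x(2)]] assms by simp
qed

lemma crit_sets_disjoint:
  assumes "C \<noteq> D"
  shows "crit_sets N S C \<inter> crit_sets N S D = {}"
proof (rule equals0I)
  fix x assume "x \<in> crit_sets N S C \<inter> crit_sets N S D"
  then have x: "x \<in> crit_sets N S C" "x \<in> crit_sets N S D" by simp_all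
  show False using crit_unique[OF crit_setsD(3)[OF x(1)] crit_setsD(3)[OF x(2)]] assms by simp
qed

lemma card_UN_crit_vecs:
  fixes N :: "'a \<Rightarrow> 'b set"
  assumes "finite S" "\<And>s. finite (N s)"
  shows "card (\<Union>C\<in>{C. C \<subseteq> S \<and> P C}. crit_vecs N S C) = (\<Sum>C | C \<subseteq> S \<and> P C. card (crit_vecs N S C))"
proof (rule card_UN_disjoint)
  show "finite {C. C \<subseteq> S \<and> P C}" using assms(1) by simp
qed (intro ballI impI finite_crit_vecs[of S N, OF assms] crit_vecs_disjoint)+

lemma card_UN_crit_sets:
  fixes N :: "'a \<Rightarrow> 'b set"
  assumes "finite S" "\<And>s. finite (N s)"
  shows "card (\<Union>C\<in>{C. C \<subseteq> S \<and> P C}. crit_sets N S C) = (\<Sum>C | C \<subseteq> S \<and> P C. card (crit_sets N S C))"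
proof (rule card_UN_disjoint)
  show "finite {C. C \<subseteq> S \<and> P C}" using assms(1) by simp
qed (intro ballI impI finite_crit_sets[of S N, OF assms] crit_sets_disjoint)+

text \<open>\<open>hall_delete\<close> sorts the vectors into those that satisfy Hall's condition
  without \<open>e\<close> and those that become critical, the latter by their unique least violated
  set.\<close>

lemma card_hall_vecs_delete:
  fixes N :: "'a \<Rightarrow> 'b set"
  assumes fin: "finite S" "\<And>s. finite (N s)"
  shows "card (hall_vecs N S) = card (hall_vecs (\<lambda>s. N s - {e}) S) +
    (\<Sum>C | C \<subseteq> S \<and> (\<exists>s\<in>C. e \<in> N s). card (crit_vecs (\<lambda>s. N s - {e}) S C))"
proof -
  let ?M = "\<lambda>s. N s - {e}"
  have finM: "finite (?M s)" for s using fin by simp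
  let ?I = "{C. C \<subseteq> S \<and> (\<exists>s\<in>C. e \<in> N s)}"
  have eq: "hall_vecs N S = hall_vecs ?M S \<union> (\<Union>C\<in>?I. crit_vecs ?M S C)"
  proof (rule set_eqI)
    fix x
    show "x \<in> hall_vecs N S \<longleftrightarrow> x \<in> hall_vecs ?M S \<union> (\<Union>C\<in>?I. crit_vecs ?M S C)"
      using hall_delete[of S N x e, OF fin] crit_subset[of x ?M S]
      unfolding hall_vecs_def crit_vecs_def Un_iff UN_iff mem_Collect_eq by blast
  qed
  have "hall_vecs ?M S \<inter> (\<Union>C\<in>?I. crit_vecs ?M S C) = {}"
    using crit_not_hall[OF crit_vecsD(2)] hall_vecsD(2) by blast
  then have "card (hall_vecs N S) = card (hall_vecs ?M S) + card (\<Union>C\<in>?I. crit_vecs ?M S C)"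
    unfolding eq using fin(1) finM
    by (intro card_Un_disjoint finite_hall_vecs finite_UN_I finite_crit_vecs) simp_all
  then show ?thesis using card_UN_crit_vecs[of S ?M, OF fin(1) finM] by simp
qed

text \<open>Sets avoiding \<open>e\<close> give the first term. Removing \<open>e\<close> from the
  others leaves one element fewer than \<open>S\<close> has, which turns them into critical sets of
  the smaller graph.\<close>

lemma card_hall_sets_delete:
  fixes N :: "'a \<Rightarrow> 'b set"
  assumes fin: "finite S" "\<And>s. finite (N s)" and e: "e \<in> \<Union>(N ` S)"
  shows "card (hall_sets N S) = card (hall_sets (\<lambda>s. N s - {e}) S) +
    (\<Sum>C | C \<subseteq> S \<and> (\<exists>s\<in>C. e \<in> N s). card (crit_sets (\<lambda>s. N s - {e}) S C))"
proof -
  let ?M = "\<lambda>s. N s - {e}"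
  have finM: "finite (?M s)" for s using fin by simp
  let ?I = "{C. C \<subseteq> S \<and> (\<exists>s\<in>C. e \<in> N s)}"
  let ?Q = "\<Union>C\<in>?I. crit_sets ?M S C"
  have finT: "finite T" if "T \<subseteq> \<Union>(N ` S)" for T
    using finite_subset_nbhd[of S N, OF fin that subset_refl] .
  have sub: "\<Union>(?M ` S) \<subseteq> \<Union>(N ` S)" "e \<notin> \<Union>(?M ` S)" by auto
  have with_e: "insert e T \<in> hall_sets N S \<longleftrightarrow> T \<in> ?Q" if T: "T \<subseteq> \<Union>(?M ` S)" for T
  proof -
    have fT: "finite T" and eT: "e \<notin> T" using T sub finT by auto
    have N: "(\<lambda>s. N s \<inter> insert e T - {e}) = (\<lambda>s. ?M s \<inter> T)" using eT by auto
    \<comment> \<open>With fewer elements than \<open>S\<close>, the set \<open>T\<close> cannot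
      satisfy Hall's condition, so only the critical alternative of \<open>hall_delete\<close>
      remains.\<close>
    have "\<not> hall (\<lambda>_. 1) (\<lambda>s. ?M s \<inter> T) S" if "Suc (card T) = card S"
    proof
      assume "hall (\<lambda>_. 1) (\<lambda>s. ?M s \<inter> T) S"
      then have "card S \<le> card (\<Union>((\<lambda>s. ?M s \<inter> T) ` S))" using subset_refl by (rule hall_one_cardD)
      also have "\<dots> \<le> card T" using fT by (intro card_mono) auto
      finally show False using that by simp
    qed
    moreover have "hall (\<lambda>_. 1) (\<lambda>s. N s \<inter> insert e T) S \<longleftrightarrow> hall (\<lambda>_. 1) (\<lambda>s. ?M s \<inter> T) S \<or>
       (\<exists>C. crit (\<lambda>_. 1) (\<lambda>s. ?M s \<inter> T) S C \<and> (\<exists>s\<in>C. e \<in> N s))"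
      using hall_delete[of S "\<lambda>s. N s \<inter> insert e T" "\<lambda>_. 1" e] fin unfolding N by simp
    moreover have "insert e T \<in> hall_sets N S \<longleftrightarrow>
        Suc (card T) = card S \<and> hall (\<lambda>_. 1) (\<lambda>s. N s \<inter> insert e T) S"
    proof -
      have "insert e T \<subseteq> \<Union>(N ` S)" using T sub e by blast
      moreover have "card (insert e T) = Suc (card T)" using fT eT by simp
      ultimately show ?thesis unfolding hall_sets_def by simp
    qed
    ultimately have "insert e T \<in> hall_sets N S \<longleftrightarrow> Suc (card T) = card S \<and>
        (\<exists>C. crit (\<lambda>_. 1) (\<lambda>s. ?M s \<inter> T) S C \<and> (\<exists>s\<in>C. e \<in> N s))"
      by argo
    also have "\<dots> \<longleftrightarrow> T \<in> ?Q"
      using T crit_subset[of "\<lambda>_. 1" "\<lambda>s. ?M s \<inter> T" S]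
      unfolding crit_sets_def UN_iff mem_Collect_eq by blast
    finally show ?thesis .
  qed
  have without_e: "T \<in> hall_sets N S \<longleftrightarrow> T \<in> hall_sets ?M S" if "e \<notin> T" for T
  proof -
    have "(\<lambda>s. N s \<inter> T) = (\<lambda>s. ?M s \<inter> T)" using that by auto
    moreover have "T \<subseteq> \<Union>(N ` S) \<longleftrightarrow> T \<subseteq> \<Union>(?M ` S)" using that by auto
    ultimately show ?thesis unfolding hall_sets_def by simp
  qed
  have Q: "?Q \<subseteq> Pow (\<Union>(?M ` S))" by (intro UN_least subsetI PowI crit_setsD(1))
  have H: "hall_sets ?M S \<subseteq> Pow (\<Union>(?M ` S))" by (intro subsetI PowI hall_setsD(1))
  have eq: "hall_sets N S = hall_sets ?M S \<union> insert e ` ?Q"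
  proof (intro set_eqI iffI)
    fix T assume T: "T \<in> hall_sets N S"
    show "T \<in> hall_sets ?M S \<union> insert e ` ?Q"
    proof (cases "e \<in> T")
      case True
      then have T': "T = insert e (T - {e})" by blast
      have sub': "T - {e} \<subseteq> \<Union>(?M ` S)" using hall_setsD(1)[OF T] by blast
      have "T - {e} \<in> ?Q" using T T' unfolding with_e[OF sub', symmetric] by argo
      with T' show ?thesis by blast
    next
      case False
      then show ?thesis using T by (simp only: without_e Un_iff simp_thms)
    qed
  next
    fix T assume "T \<in> hall_sets ?M S \<union> insert e ` ?Q"
    then show "T \<in> hall_sets N S"
    proof
      assume T: "T \<in> hall_sets ?M S"
      then have eT: "e \<notin> T" using H sub(2) by blast
      show ?thesis using T unfolding without_e[OF eT] .
    next
      assume "T \<in> insert e ` ?Q"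
      then obtain T' where "T = insert e T'" "T' \<in> ?Q" by blast
      moreover from this have "T' \<subseteq> \<Union>(?M ` S)" using Q by blast
      ultimately show ?thesis by (simp only: with_e)
    qed
  qed
  have "card (hall_sets N S) = card (hall_sets ?M S) + card (insert e ` ?Q)"
    unfolding eq
  proof (rule card_Un_disjoint)
    show "hall_sets ?M S \<inter> insert e ` ?Q = {}" using H sub(2) by blast
    show "finite (hall_sets ?M S)" by (rule finite_hall_sets[OF fin(1) finM])
    show "finite (insert e ` ?Q)"
      using fin(1) finM by (intro finite_imageI finite_UN_I finite_crit_sets) simp_all
  qed
  also have "card (insert e ` ?Q) = card ?Q"
  proof (rule card_image, rule inj_onI)
    fix A B assume "A \<in> ?Q" "B \<in> ?Q" and AB: "insert e A = insert e B"
    then have eAB: "e \<notin> A" "e \<notin> B" using Q sub(2) by blast+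
    show "A = B" using AB unfolding insert_ident[OF eAB] .
  qed
  finally show ?thesis using card_UN_crit_sets[of S ?M, OF fin(1) finM] by simp
qed

section \<open>Least violated sets through a fixed left-hand vertex\<close>

text \<open>The union over \<open>C\<close> is rewritten by \<open>crit_mem_iff\<close>. Failure on
  \<open>S\<close> follows from the size of \<open>T\<close>, and the bound on the excess from
  Hall's condition on \<open>S - {s}\<close>, so only the latter condition remains.\<close>

lemma sum_card_crit_sets:
  fixes N :: "'a \<Rightarrow> 'b set"
  assumes fin: "finite S" "\<And>s. finite (N s)" and s: "s \<in> S"
  shows "(\<Sum>C | C \<subseteq> S \<and> s \<in> C. card (crit_sets N S C)) = card (hall_sets N (S - {s}))"
proof -
  have cS: "card S = Suc (card (S - {s}))" using fin(1) s by (metis card.remove)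
  have finT: "finite T" if "T \<subseteq> \<Union>(N ` S)" for T
    using finite_subset_nbhd[of S N, OF fin that subset_refl] .
  have "(\<Union>C\<in>{C. C \<subseteq> S \<and> s \<in> C}. crit_sets N S C) = hall_sets N (S - {s})"
  proof (intro set_eqI)
    fix T
    let ?M = "\<lambda>s. N s \<inter> T"
    have T_le: "card (\<Union>(?M ` A)) \<le> card T" if "T \<subseteq> \<Union>(N ` S)" for A
      using finT[OF that] by (intro card_mono) auto
    have "T \<in> (\<Union>C\<in>{C. C \<subseteq> S \<and> s \<in> C}. crit_sets N S C) \<longleftrightarrow>
       T \<subseteq> \<Union>(N ` S) \<and> card T = card (S - {s}) \<and> (\<exists>C. s \<in> C \<and> crit (\<lambda>_. 1) ?M S C)"
    proof -
      have "Suc (card T) = card S \<longleftrightarrow> card T = card (S - {s})" using cS by simp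
      then show ?thesis
        using crit_subset[of "\<lambda>_. 1" ?M S] unfolding crit_sets_def UN_iff mem_Collect_eq by blast
    qed
    also have "\<dots> \<longleftrightarrow> T \<subseteq> \<Union>(N ` S) \<and> card T = card (S - {s}) \<and> hall (\<lambda>_. 1) ?M (S - {s})"
    proof (intro conj_cong refl)
      assume T: "T \<subseteq> \<Union>(N ` S)" "card T = card (S - {s})"
      have "\<not> hall (\<lambda>_. 1) ?M S"
      proof
        assume "hall (\<lambda>_. 1) ?M S"
        then have "card S \<le> card (\<Union>(?M ` S))" using subset_refl by (rule hall_one_cardD)
        then show False using T_le[OF T(1), of S] T(2) cS by linarith
      qed
      moreover have "\<forall>A\<subseteq>S. (\<Sum>_\<in>A. 1) \<le> Suc (card (\<Union>(?M ` A)))"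
        if h: "hall (\<lambda>_. 1) ?M (S - {s})"
      proof (intro allI impI)
        fix A assume A: "A \<subseteq> S"
        then have fA: "finite A" using fin(1) finite_subset by blast
        have "A - {s} \<subseteq> S - {s}" using A by blast
        from hall_one_cardD[OF h this] have "card (A - {s}) \<le> card (\<Union>(?M ` (A - {s})))" .
        moreover have "\<dots> \<le> card (\<Union>(?M ` A))"
          using fin(2) fA by (intro card_nbhd_mono) auto
        moreover have "card A \<le> Suc (card (A - {s}))" by (cases "s \<in> A") (simp_all add: card_Suc_Diff1[OF fA] del: card_Diff_insert)
        ultimately show "(\<Sum>_\<in>A. 1) \<le> Suc (card (\<Union>(?M ` A)))"
          unfolding card_eq_sum[symmetric] by linarith
      qed
      ultimately show "(\<exists>C. s \<in> C \<and> crit (\<lambda>_. 1) ?M S C) = hall (\<lambda>_. 1) ?M (S - {s})"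
        using crit_mem_iff[of S ?M s "\<lambda>_. 1"] fin s by blast
    qed
    also have "\<dots> \<longleftrightarrow> T \<in> hall_sets N (S - {s})"
    proof -
      \<comment> \<open>Hall's condition for all of \<open>S - {s}\<close> uses up every element of
        \<open>T\<close>, so none is adjacent to \<open>s\<close> alone.\<close>
      have "T \<subseteq> \<Union>(N ` (S - {s}))"
        if T: "T \<subseteq> \<Union>(N ` S)" "card T = card (S - {s})" and h: "hall (\<lambda>_. 1) ?M (S - {s})"
      proof -
        have "card (S - {s}) \<le> card (\<Union>(?M ` (S - {s})))"
          by (rule hall_one_cardD[OF h subset_refl])
        then have "card T \<le> card (\<Union>(?M ` (S - {s})))" unfolding T(2) .
        then have "\<Union>(?M ` (S - {s})) = T" using finT[OF T(1)] by (intro card_seteq) auto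
        then show ?thesis by blast
      qed
      moreover have "\<Union>(N ` (S - {s})) \<subseteq> \<Union>(N ` S)" by blast
      ultimately show ?thesis unfolding hall_sets_def mem_Collect_eq by blast
    qed
    finally show "T \<in> (\<Union>C\<in>{C. C \<subseteq> S \<and> s \<in> C}. crit_sets N S C) \<longleftrightarrow> T \<in> hall_sets N (S - {s})" .
  qed
  then show ?thesis using card_UN_crit_sets[of S N, OF fin, of "\<lambda>C. s \<in> C"] by argo
qed

text \<open>The bijection forgets the value at \<open>s\<close>: given the other values, exactly one
  value there makes the largest excess equal to one.\<close>

lemma sum_card_crit_vecs:
  fixes N :: "'a \<Rightarrow> 'b set"
  assumes fin: "finite S" "\<And>s. finite (N s)" and s: "s \<in> S"
  shows "(\<Sum>C | C \<subseteq> S \<and> s \<in> C. card (crit_vecs N S C)) = card (hall_vecs N (S - {s}))"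
proof -
  let ?Q = "\<Union>C\<in>{C. C \<subseteq> S \<and> s \<in> C}. crit_vecs N S C"
  have Q: "x \<in> ?Q \<longleftrightarrow> {s. 0 < x s} = S \<and> (\<forall>A\<subseteq>S. sum x A \<le> Suc (card (\<Union>(N ` A)))) \<and>
     \<not> hall x N S \<and> hall x N (S - {s})" for x
    using crit_mem_iff[of S N, OF fin s, of x] crit_subset[of x N S]
    unfolding crit_vecs_def UN_iff mem_Collect_eq by blast
  have split: "sum x A = x s + sum x (A - {s})" if "A \<subseteq> S" "s \<in> A" for A and x :: "'a \<Rightarrow> nat"
    using that fin(1) by (meson finite_subset sum.remove)
  let ?f = "\<lambda>x. x(s := 0)"
  have hf: "hall x N (S - {s}) = hall (x(s := k)) N (S - {s})" for x k
    by (rule hall_cong) auto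
  have "bij_betw ?f ?Q (hall_vecs N (S - {s}))"
    unfolding bij_betw_def
  proof
    show "inj_on ?f ?Q"
    proof (rule inj_onI, rule ccontr)
      \<comment> \<open>A set violated by \<open>x\<close> must contain \<open>s\<close>, so the
        larger value of \<open>y\<close> at \<open>s\<close> would give it excess at least
        two.\<close>
      have lt: False if x: "x \<in> ?Q" and y: "y \<in> ?Q" and eq: "?f x = ?f y" and lt: "x s < y s" for x y
      proof -
        have nh: "\<not> hall x N S" and h: "hall x N (S - {s})" using x unfolding Q by blast+
        obtain A where A: "A \<subseteq> S" "sum x A > card (\<Union>(N ` A))"
          using nh unfolding hall_def not_all not_imp not_le by blast
        have sA: "s \<in> A"
        proof (rule ccontr)
          assume "s \<notin> A"
          then have "A \<subseteq> S - {s}" using A(1) by blast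
          from hallD[OF h this] show False using A(2) by linarith
        qed
        have "x t = y t" if "t \<noteq> s" for t using fun_cong[OF eq, of t] that by simp
        then have "sum x (A - {s}) = sum y (A - {s})" by (intro sum.cong) auto
        then have "sum x A < sum y A" using lt unfolding split[OF A(1) sA] by linarith
        moreover have "sum y A \<le> Suc (card (\<Union>(N ` A)))" using y A unfolding Q by blast
        ultimately show False using A(2) by linarith
      qed
      fix x y assume xy: "x \<in> ?Q" "y \<in> ?Q" "?f x = ?f y" "x \<noteq> y"
      have "x = y" if "x s = y s"
        using fun_cong[OF xy(3)] that by (intro ext) (metis fun_upd_other)
      then have "x s < y s \<or> y s < x s" using xy(4) by linarith
      then show False using lt[OF xy(1,2,3)] lt[OF xy(2,1) xy(3)[symmetric]] by blast
    qed
    show "?f ` ?Q = hall_vecs N (S - {s})"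
    proof (intro subset_antisym subsetI)
      fix y assume "y \<in> ?f ` ?Q"
      then obtain x where x: "x \<in> ?Q" and y: "y = ?f x" by blast
      have "{t. 0 < x t} = S" and "hall x N (S - {s})" using x unfolding Q by blast+
      moreover have "{t. 0 < y t} = {t. 0 < x t} - {s}" unfolding y by auto
      ultimately show "y \<in> hall_vecs N (S - {s})"
        using hf[of x 0] unfolding hall_vecs_def y by simp
    next
      fix y assume y: "y \<in> hall_vecs N (S - {s})"
      then have h: "hall y N (S - {s})" and sy: "{s. 0 < y s} = S - {s}"
        using hall_vecsD by blast+
      have "s \<notin> {s. 0 < y s}" unfolding sy by blast
      then have ys: "y s = 0" by simp
      let ?A = "{A. A \<subseteq> S \<and> s \<in> A}"
      \<comment> \<open>The subtraction is not truncated on \<open>?A\<close>, by the fact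
        \<open>le\<close> below.\<close>
      let ?slack = "\<lambda>A. card (\<Union>(N ` A)) - sum y (A - {s})"
      have fA: "finite ?A" using fin(1) by simp
      have neA: "?A \<noteq> {}" using s by auto
      \<comment> \<open>The only value at \<open>s\<close> for which the worst violation is by exactly one.\<close>
      define k where "k = Suc (Min (?slack ` ?A))"
      have kle: "k \<le> Suc (?slack A)" if "A \<in> ?A" for A
        unfolding k_def using fA that by simp
      obtain A0 where A0: "A0 \<in> ?A" "k = Suc (?slack A0)"
      proof -
        have "Min (?slack ` ?A) \<in> ?slack ` ?A" using fA neA by (intro Min_in) simp_all
        then show ?thesis using that unfolding k_def by (elim imageE) simp
      qed
      have le: "sum y (A - {s}) \<le> card (\<Union>(N ` A))" if "A \<subseteq> S" for A
      proof -
        have "sum y (A - {s}) \<le> card (\<Union>(N ` (A - {s})))" using that by (intro hallD[OF h]) auto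
        also have "\<dots> \<le> card (\<Union>(N ` A))"
          using finite_subset[OF that fin(1)] fin(2) by (intro card_nbhd_mono) auto
        finally show ?thesis .
      qed
      let ?x = "y(s := k)"
      have xs: "sum ?x A = k + sum y (A - {s})" if "A \<subseteq> S" "s \<in> A" for A
      proof -
        have "sum ?x (A - {s}) = sum y (A - {s})" by (intro sum.cong) auto
        then show ?thesis using split[OF that, of ?x] by simp
      qed
      have "sum ?x A \<le> Suc (card (\<Union>(N ` A)))" if A: "A \<subseteq> S" for A
      proof (cases "s \<in> A")
        case True
        then have "k \<le> Suc (?slack A)" using A by (intro kle) simp
        then show ?thesis using le[OF A] unfolding xs[OF A True] by linarith
      next
        case False
        then have "sum ?x A = sum y (A - {s})" by (intro sum.cong) auto
        then show ?thesis using le[OF A] by linarith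
      qed
      moreover have "\<not> hall ?x N S"
      proof
        assume "hall ?x N S"
        moreover have A0S: "A0 \<subseteq> S" "s \<in> A0" using A0(1) by blast+
        ultimately have "sum ?x A0 \<le> card (\<Union>(N ` A0))" by (intro hallD)
        then show False using A0(2) le[OF A0S(1)] unfolding xs[OF A0S] by linarith
      qed
      \<comment> \<open>\<open>k\<close> is a successor, hence positive even if the least slack is
        0, so \<open>s\<close> joins the support.\<close>
      moreover have "{t. 0 < ?x t} = insert s {t. 0 < y t}" by (auto simp: k_def)
      then have "{t. 0 < ?x t} = S" unfolding sy insert_Diff[OF s] .
      moreover have "hall ?x N (S - {s})" using h hf[of y k] by blast
      ultimately have "?x \<in> ?Q" unfolding Q by blast
      then have "?f ?x \<in> ?f ` ?Q" by (rule imageI)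
      moreover have "?f ?x = y" using ys by auto
      ultimately show "y \<in> ?f ` ?Q" by argo
    qed
  qed
  from bij_betw_same_card[OF this] show ?thesis
    using card_UN_crit_vecs[of S N, OF fin, of "\<lambda>C. s \<in> C"] by argo
qed

section \<open>Equality of the two counts\<close>

lemma card_hall_empty [simp]: "card (hall_vecs N {}) = 1" "card (hall_sets N {}) = 1"
proof -
  have "hall_vecs N {} = {\<lambda>_. 0}" by (auto simp: hall_vecs_def hall_def)
  then show "card (hall_vecs N {}) = 1" by simp
  have "hall_sets N {} = {{}}" by (auto simp: hall_sets_def hall_def)
  then show "card (hall_sets N {}) = 1" by simp
qed

text \<open>The two equalities feed each other at smaller sets, hence the joint induction on
  \<open>card S\<close>. \<open>N\<close> stays arbitrary because factoring and deletion change the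
  graph.\<close>

lemma card_vecs_eq_card_sets:
  fixes N :: "'a \<Rightarrow> 'b set"
  assumes "finite S" "\<And>s. finite (N s)"
  shows "card (hall_vecs N S) = card (hall_sets N S) \<and> card (crit_vecs N S S) = card (crit_sets N S S)"
  using assms
proof (induction "card S" arbitrary: S N rule: less_induct)
  case less
  note fin = less.prems
  show ?case
  proof (cases "S = {}")
    case True
    \<comment> \<open>Both Hall counts are 1 here, and both critical counts are 0 because the empty
      set has excess 0.\<close>
    then show ?thesis by (simp add: crit_vecs_def crit_sets_def crit_def)
  next
    case False
    then obtain s where s: "s \<in> S" by blast
    have small: "card A < card S" if "A \<subset> S" for A
      using fin(1) that by (rule psubset_card_mono)
    have finA: "finite A" if "A \<subseteq> S" for A using that fin(1) finite_subset by blast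
    \<comment> \<open>For \<open>C\<close> proper and nonempty, \<open>C\<close> and
      \<open>S - C\<close> are both smaller than \<open>S\<close>, so both factors are covered by
      induction.\<close>
    have crit_eq: "card (crit_vecs N S C) = card (crit_sets N S C)"
      if fN: "\<And>s. finite (N s)" and C: "C \<subset> S" "C \<noteq> {}" for C and N :: "'a \<Rightarrow> 'b set"
    proof -
      have "card (crit_vecs N C C) = card (crit_sets N C C)"
        using less.hyps[of C N] small[of C] finA[of C] C fN by blast
      moreover have "card (hall_vecs (\<lambda>s. N s - \<Union>(N ` C)) (S - C)) =
          card (hall_sets (\<lambda>s. N s - \<Union>(N ` C)) (S - C))"
        using less.hyps[of "S - C" "\<lambda>s. N s - \<Union>(N ` C)"] small[of "S - C"] finA[of "S - C"] C fN
        by blast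
      ultimately show ?thesis
        using card_crit_vecs_factor[of S N, OF fin(1) fN, of C] card_crit_sets_factor[of S N, OF fin(1) fN, of C] C
        by simp
    qed
    have top: "card (crit_vecs N S S) = card (crit_sets N S S)"
      if fN: "\<And>s. finite (N s)" for N :: "'a \<Rightarrow> 'b set"
    proof -
      \<comment> \<open>The term \<open>C = S\<close> is isolated: the totals over \<open>?I\<close>
        agree by induction at \<open>S - {s}\<close>, and the terms with \<open>C\<close> proper by
        \<open>crit_eq\<close>.\<close>
      let ?I = "{C. C \<subseteq> S \<and> s \<in> C}"
      have I: "finite ?I" "S \<in> ?I" using fin(1) s by auto
      have "(\<Sum>C\<in>?I. card (crit_vecs N S C)) = (\<Sum>C\<in>?I. card (crit_sets N S C))"
        using sum_card_crit_vecs[of S N, OF fin(1) fN s] sum_card_crit_sets[of S N, OF fin(1) fN s]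
          less.hyps[of "S - {s}" N] small[of "S - {s}"] s finA[of "S - {s}"] fN by auto
      moreover have "(\<Sum>C\<in>?I - {S}. card (crit_vecs N S C)) = (\<Sum>C\<in>?I - {S}. card (crit_sets N S C))"
        by (intro sum.cong crit_eq fN) auto
      ultimately show ?thesis
        using sum.remove[OF I, of "\<lambda>C. card (crit_vecs N S C)"]
          sum.remove[OF I, of "\<lambda>C. card (crit_sets N S C)"] by simp
    qed
    have "card (hall_vecs N S) = card (hall_sets N S)"
      if fN: "\<And>s. finite (N s)" for N :: "'a \<Rightarrow> 'b set"
      using fN
    proof (induction "card (\<Union>(N ` S))" arbitrary: N rule: less_induct)
      case (less N)
      have fU: "finite (\<Union>(N ` S))" using less.prems fin(1) by blast
      show ?case
      proof (cases "\<Union>(N ` S) = {}")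
        case True
        \<comment> \<open>Without neighbours both families are empty: a positive value at
          \<open>s\<close> exceeds 0, and only the empty \<open>T\<close> is available for the
          nonempty \<open>S\<close>.\<close>
        have "hall_vecs N S = {}"
        proof (intro equals0I)
          fix x assume x: "x \<in> hall_vecs N S"
          then have "sum x {s} \<le> card (\<Union>(N ` {s}))"
            using s by (intro hallD[of x N S]) (auto simp: hall_vecs_def)
          moreover have "0 < x s" using x s by (auto simp: hall_vecs_def)
          moreover have "N s = {}" using True s by auto
          ultimately show False by simp
        qed
        moreover have "hall_sets N S = {}"
          using True False fin(1) by (auto simp: hall_sets_def)
        ultimately show ?thesis by simp
      next
        case False
        then obtain e where e: "e \<in> \<Union>(N ` S)" by blast
        let ?M = "\<lambda>s. N s - {e}"
        have fM: "finite (?M s)" for s using less.prems by simp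
        have "\<Union>(?M ` S) \<subset> \<Union>(N ` S)" using e by auto
        then have "card (hall_vecs ?M S) = card (hall_sets ?M S)"
          using fU fM by (intro less.hyps psubset_card_mono) auto
        moreover have "card (crit_vecs ?M S C) = card (crit_sets ?M S C)"
          if "C \<in> {C. C \<subseteq> S \<and> (\<exists>s\<in>C. e \<in> N s)}" for C
        proof (cases "C = S")
          case True
          then show ?thesis using top[of ?M] fM by simp
        next
          case False
          then show ?thesis using that by (intro crit_eq fM) auto
        qed
        ultimately show ?thesis
          using card_hall_vecs_delete[of S N e] card_hall_sets_delete[of S N e] fin(1) less.prems e
          by simp
      qed
    qed
    then show ?thesis using top fin(2) by blast
  qed
qed

section \<open>Matched pairs and their symmetry under duality\<close>

text \<open>Since \<open>|S| = |T|\<close>, Hall's condition for \<open>S\<close> says that \<open>S\<close> and \<open>T\<close> are perfectly matched.\<close>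
definition hall_pairs :: "nat \<Rightarrow> nat rel \<Rightarrow> nat \<Rightarrow> (nat set \<times> nat set) set" where
  "hall_pairs n r k = {(S, T). S \<subseteq> {1..n} \<and> T \<subseteq> {1..n} \<and> card S = k \<and> card T = k \<and>
     (\<forall>A\<subseteq>S. card A \<le> card {b \<in> T. \<exists>a\<in>A. (b, a) \<in> r})}"

lemma hall_pairs_swap:
  assumes "(S, T) \<in> hall_pairs n r k"
  shows "(T, S) \<in> hall_pairs n (r\<inverse>) k"
proof -
  have ST: "S \<subseteq> {1..n}" "T \<subseteq> {1..n}" "card S = k" "card T = k"
    and h: "\<And>A. A \<subseteq> S \<Longrightarrow> card A \<le> card {b \<in> T. \<exists>a\<in>A. (b, a) \<in> r}"
    using assms by (auto simp: hall_pairs_def)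
  have fin: "finite S" "finite T" using ST finite_subset by blast+
  \<comment> \<open>Apply Hall's condition to the elements of \<open>S\<close> without neighbours in \<open>B\<close>.\<close>
  have "card B \<le> card {a \<in> S. \<exists>b\<in>B. (b, a) \<in> r}" (is "_ \<le> card ?N") if B: "B \<subseteq> T" for B
  proof -
    have "k - card ?N = card (S - ?N)" using ST fin by (simp add: card_Diff_subset)
    also have "\<dots> \<le> card {b \<in> T. \<exists>a\<in>S - ?N. (b, a) \<in> r}" by (rule h) auto
    also have "\<dots> \<le> card (T - B)" using fin by (intro card_mono) auto
    also have "\<dots> = k - card B" using ST fin B by (simp add: card_Diff_subset finite_subset)
    finally have "k - card ?N \<le> k - card B" .
    moreover have "card B \<le> k" using B fin ST by (metis card_mono)
    ultimately show ?thesis by linarith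
  qed
  then show ?thesis using ST by (auto simp: hall_pairs_def)
qed

lemma card_hall_pairs_converse: "card (hall_pairs n (r\<inverse>) k) = card (hall_pairs n r k)"
proof -
  have "bij_betw prod.swap (hall_pairs n (r\<inverse>) k) (hall_pairs n r k)"
    by (rule bij_betw_byWitness[where f' = prod.swap])
      (auto dest: hall_pairs_swap[of _ _ n r] hall_pairs_swap[of _ _ n "r\<inverse>"])
  then show ?thesis by (rule bij_betw_same_card)
qed

section \<open>Lattice points of the preorder polytope\<close>

text \<open>By transitivity the neighbourhood of \<open>A\<close> is an order ideal, and by
  reflexivity it contains \<open>A\<close>, so the ideal inequalities give Hall's condition.
  Conversely, the neighbours of \<open>I \<inter> S\<close> stay in the ideal \<open>I\<close>, and
  \<open>x\<close> vanishes on the rest of \<open>I\<close>.\<close>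

lemma lattice_point_iff:
  fixes x :: "nat \<Rightarrow> nat"
  assumes r: "preorder_on {1..n} r" and supp: "{s. 0 < x s} = S" and S: "S \<subseteq> {1..n}"
  shows "hall x (\<lambda>j. {i. (i, j) \<in> r}) S \<longleftrightarrow>
     restrict (\<lambda>i. real (x i)) {1..n} \<in> polytope_lattice_points n r"
proof -
  let ?N = "\<lambda>j. {i. (i, j) \<in> r}"
  have r': "r \<subseteq> {1..n} \<times> {1..n}" "refl_on {1..n} r" "trans r"
    using r by (auto simp: preorder_on_def)
  have finN: "finite (\<Union>(?N ` A))" for A
    by (rule finite_subset[of _ "{1..n}"]) (use r' in auto)
  have sum_r: "(\<Sum>i\<in>I. restrict (\<lambda>i. real (x i)) {1..n} i) = real (sum x I)" if "I \<subseteq> {1..n}" for I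
    using that by (auto intro!: sum.cong)
  have "hall x ?N S \<longleftrightarrow> (\<forall>I. order_ideal n r I \<longrightarrow> sum x I \<le> card I)"
  proof
    assume h: "hall x ?N S"
    show "\<forall>I. order_ideal n r I \<longrightarrow> sum x I \<le> card I"
    proof (intro allI impI)
      fix I assume I: "order_ideal n r I"
      then have fI: "finite I" by (auto simp: order_ideal_def intro: finite_subset)
      have "sum x I = sum x (I \<inter> S)"
        using fI supp by (intro sum.mono_neutral_right) auto
      also have "\<dots> \<le> card (\<Union>(?N ` (I \<inter> S)))" by (rule hallD[OF h]) auto
      also have "\<dots> \<le> card I" using fI I by (intro card_mono) (auto simp: order_ideal_def)
      finally show "sum x I \<le> card I" .
    qed
  next
    assume h: "\<forall>I. order_ideal n r I \<longrightarrow> sum x I \<le> card I"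
    show "hall x ?N S" unfolding hall_def
    proof (intro allI impI)
      fix A assume A: "A \<subseteq> S"
      have "sum x A \<le> sum x (\<Union>(?N ` A))"
      proof (rule sum_mono2[OF finN])
        have "(a, a) \<in> r" if "a \<in> A" for a using that A S refl_onD[OF r'(2)] by blast
        then show "A \<subseteq> \<Union>(?N ` A)" by blast
      qed simp
      also have "\<dots> \<le> card (\<Union>(?N ` A))"
      proof -
        have "order_ideal n r (\<Union>(?N ` A))"
          using r' unfolding order_ideal_def by (auto dest: transD)
        then show ?thesis using h by blast
      qed
      finally show "sum x A \<le> card (\<Union>(?N ` A))" .
    qed
  qed
  also have "\<dots> \<longleftrightarrow> restrict (\<lambda>i. real (x i)) {1..n} \<in> polytope_lattice_points n r"
  proof -
    define z where "z = restrict (\<lambda>i. real (x i)) {1..n}"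
    have "sum x I \<le> card I \<longleftrightarrow> sum z I \<le> real (card I)" if "order_ideal n r I" for I
    proof -
      have "I \<subseteq> {1..n}" using that by (simp add: order_ideal_def)
      from sum_r[OF this] show ?thesis unfolding z_def by (simp only: of_nat_le_iff)
    qed
    moreover have "z \<in> extensional {1..n}" "\<forall>i\<in>{1..n}. 0 \<le> z i" "\<forall>i\<in>{1..n}. z i \<in> \<int>"
      unfolding z_def by simp_all
    ultimately show ?thesis
      unfolding z_def[symmetric] polytope_lattice_points_def preorder_polytope_def by blast
  qed
  finally show ?thesis .
qed

text \<open>Lattice points are sorted by their support \<open>S\<close>; for each \<open>S\<close>
  the number of vectors is replaced by the number of sets \<open>T\<close>, and the sum becomes a
  count of pairs.\<close>

lemma h_coeff_eq_card_hall_pairs: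
  assumes r: "preorder_on {1..n} r"
  shows "h_coeff n r k = card (hall_pairs n r k)"
proof -
  let ?N = "\<lambda>j. {i. (i, j) \<in> r}"
  have r': "r \<subseteq> {1..n} \<times> {1..n}" using r by (auto simp: preorder_on_def)
  have finN: "finite (?N j)" for j
    by (rule finite_subset[of _ "{1..n}"]) (use r' in auto)
  let ?I = "{S. S \<subseteq> {1..n} \<and> card S = k}"
  have finI: "finite ?I" by simp
  have finS: "finite S" if "S \<in> ?I" for S using that finite_subset by blast
  let ?P = "{x \<in> polytope_lattice_points n r. card {j \<in> {1..n}. 0 < x j} = k}"
  let ?f = "\<lambda>x. restrict (\<lambda>i. real (x i)) {1..n}"
  \<comment> \<open>The floor is exact on the integer coordinates; the default 0 keeps the support
    inside \<open>{1..n}\<close>.\<close>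
  let ?g = "\<lambda>x i. if i \<in> {1..n} then nat \<lfloor>x i\<rfloor> else 0"
  have "bij_betw ?f (\<Union>S\<in>?I. hall_vecs ?N S) ?P"
  proof (rule bij_betw_byWitness[where f' = ?g])
    show "\<forall>x\<in>\<Union>S\<in>?I. hall_vecs ?N S. ?g (?f x) = x"
      by (fastforce simp: hall_vecs_def)
    have fg: "?f (?g x) = x" if "x \<in> ?P" for x
    proof
      fix i
      have ext: "x \<in> extensional {1..n}"
        using that by (auto simp: polytope_lattice_points_def preorder_polytope_def)
      show "?f (?g x) i = x i"
      proof (cases "i \<in> {1..n}")
        case True
        then have "0 \<le> x i" "x i \<in> \<int>"
          using that by (auto simp: polytope_lattice_points_def preorder_polytope_def)
        then show ?thesis using True by (auto elim!: Ints_cases)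
      next
        case False
        then show ?thesis using ext by (auto simp: extensional_def)
      qed
    qed
    then show "\<forall>x\<in>?P. ?f (?g x) = x" by blast
    show "?f ` (\<Union>S\<in>?I. hall_vecs ?N S) \<subseteq> ?P"
    proof (rule image_subsetI)
      fix x assume "x \<in> (\<Union>S\<in>?I. hall_vecs ?N S)"
      then obtain S where S: "S \<subseteq> {1..n}" "card S = k" "{s. 0 < x s} = S" "hall x ?N S"
        by (auto simp: hall_vecs_def)
      then have "{j \<in> {1..n}. 0 < ?f x j} = S" by auto
      then show "?f x \<in> ?P" using S lattice_point_iff[OF r S(3,1)] by simp
    qed
    show "?g ` ?P \<subseteq> (\<Union>S\<in>?I. hall_vecs ?N S)"
    proof (rule image_subsetI)
      fix x assume x: "x \<in> ?P"
      define y where "y = ?g x"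
      have xy: "x = ?f y" unfolding y_def by (rule fg[OF x, symmetric])
      have "y s = 0" if "s \<notin> {1..n}" for s unfolding y_def using that by (rule if_not_P)
      then have S: "{s. 0 < y s} \<subseteq> {1..n}" by (intro subsetI) force
      have "{j \<in> {1..n}. 0 < x j} = {s. 0 < y s}" unfolding xy using S by auto
      then have "card {s. 0 < y s} = k" using x by simp
      moreover have "hall y ?N {s. 0 < y s}"
        using lattice_point_iff[OF r refl S] x unfolding xy by blast
      ultimately show "?g x \<in> (\<Union>S\<in>?I. hall_vecs ?N S)"
        using S unfolding y_def[symmetric] hall_vecs_def by blast
    qed
  qed
  from bij_betw_same_card[OF this] have "h_coeff n r k = card (\<Union>S\<in>?I. hall_vecs ?N S)"
    unfolding h_coeff_def by (rule sym)
  also have "\<dots> = (\<Sum>S\<in>?I. card (hall_vecs ?N S))"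
  proof (rule card_UN_disjoint[OF finI])
    show "\<forall>S\<in>?I. finite (hall_vecs ?N S)" using finS finN by (intro ballI finite_hall_vecs)
    show "\<forall>S\<in>?I. \<forall>T\<in>?I. S \<noteq> T \<longrightarrow> hall_vecs ?N S \<inter> hall_vecs ?N T = {}"
      by (intro ballI impI hall_vecs_disjoint)
  qed
  also have "\<dots> = (\<Sum>S\<in>?I. card (hall_sets ?N S))"
    using finS finN card_vecs_eq_card_sets[of _ ?N] by (intro sum.cong refl) blast
  also have "\<dots> = card (Sigma ?I (hall_sets ?N))"
    using finI finS finN by (intro card_SigmaI[symmetric] ballI finite_hall_sets)
  also have "Sigma ?I (hall_sets ?N) = hall_pairs n r k"
  proof -
    have U: "\<Union>((\<lambda>s. ?N s \<inter> T) ` A) = {b \<in> T. \<exists>a\<in>A. (b, a) \<in> r}" for A T by auto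
    have sets: "T \<in> hall_sets ?N S \<longleftrightarrow> T \<subseteq> \<Union>(?N ` S) \<and> card T = card S \<and>
        (\<forall>A\<subseteq>S. card A \<le> card {b \<in> T. \<exists>a\<in>A. (b, a) \<in> r})" for S T
      by (simp only: hall_sets_def hall_def U mem_Collect_eq card_eq_sum)
    have N: "\<Union>(?N ` S) \<subseteq> {1..n}" for S using r' by blast
    show ?thesis
    proof (intro subset_antisym subrelI)
      fix S T assume "(S, T) \<in> Sigma ?I (hall_sets ?N)"
      then have S: "S \<subseteq> {1..n}" "card S = k" and T: "T \<in> hall_sets ?N S" by blast+
      have "T \<subseteq> {1..n}" using hall_setsD(1)[OF T] N by (rule subset_trans)
      then show "(S, T) \<in> hall_pairs n r k" using S T unfolding sets hall_pairs_def by simp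
    next
      fix S T assume "(S, T) \<in> hall_pairs n r k"
      then have ST: "S \<subseteq> {1..n}" "T \<subseteq> {1..n}" "card S = k" "card T = k"
        and h: "\<forall>A\<subseteq>S. card A \<le> card {b \<in> T. \<exists>a\<in>A. (b, a) \<in> r}"
        by (simp_all add: hall_pairs_def)
      have "finite T" using ST(2) by (rule finite_subset) simp
      \<comment> \<open>Hall's condition at \<open>S\<close> itself, with equal sizes, makes every
        element of \<open>T\<close> a neighbour of \<open>S\<close>, as \<open>hall_sets\<close>
        demands.\<close>
      moreover have "card T \<le> card {b \<in> T. \<exists>a\<in>S. (b, a) \<in> r}" using h[rule_format, OF subset_refl] ST(3,4) by simp
      ultimately have "{b \<in> T. \<exists>a\<in>S. (b, a) \<in> r} = T" by (intro card_seteq) auto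
      then have "T \<subseteq> \<Union>(?N ` S)" by blast
      then have "T \<in> hall_sets ?N S" unfolding sets using ST(3,4) h by simp
      then show "(S, T) \<in> Sigma ?I (hall_sets ?N)" using ST(1,3) by blast
    qed
  qed
  finally show ?thesis .
qed

theorem mainTheorem5:
  fixes n :: nat and \<tau> :: "nat rel"
  assumes "preorder_on {1..n} \<tau>"
  shows "h_poly n \<tau> = h_poly n (\<tau>\<inverse>)"
proof -
  have "preorder_on {1..n} (\<tau>\<inverse>)" using assms by (auto simp: preorder_on_def)
  then show ?thesis
    unfolding h_poly_def using assms by (simp add: h_coeff_eq_card_hall_pairs card_hall_pairs_converse)
qed

end
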